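(* Let $X$ be a Banach space with a seminormalized (Schauder) basis $(e_n)$, and let $(e_n^* )\subset X^*$ be the sequence of biorthogonal functionals. If $(e_n^* )$ is quasisubsymmetric, then $\ell_\infty$ embeds isomorphically into $\mathcal{L}(X)$.
   Context: $\mathcal{L}(X)$ is the space of bounded linear operators on $X$ with the operator norm. The biorthogonal functionals satisfy $e_n^*(e_m)=\delta_{nm}$. A sequence is seminormalized if $0<\inf_n\|e_n\|\le\sup_n\|e_n\|<\infty$. For basic sequences, $(x_n)$ dominates $(y_n)$ if there is $C>0$ with $\|\sum a_ny_n\|\le C\|\sum a_nx_n\|$ for all finitely supported scalar sequences $(a_n)$. A basic sequence $(x_n)$ is quasisubsymmetric if for any two increasing sequences $(k_n),(\ell_n)$ of positive integers with $k_n\le\ell_n$ for all $n$, $(x_{k_n})$ dominates $(x_{\ell_n})$. *)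

theory Defs
  imports "HOL-Analysis.Analysis"
begin

definition schauder_basis_of :: "'a::real_normed_vector set \<Rightarrow> (nat \<Rightarrow> 'a) \<Rightarrow> bool" where
  "schauder_basis_of S x \<longleftrightarrow> range x \<subseteq> S \<and>
     (\<forall>y\<in>S. \<exists>!a::nat \<Rightarrow> real. (\<lambda>n. a n *\<^sub>R x n) sums y)"

definition schauder_basis :: "(nat \<Rightarrow> 'a::real_normed_vector) \<Rightarrow> bool" where
  "schauder_basis x \<longleftrightarrow> schauder_basis_of UNIV x"

definition basic_sequence :: "(nat \<Rightarrow> 'a::real_normed_vector) \<Rightarrow> bool" where
  "basic_sequence x \<longleftrightarrow> schauder_basis_of (closure (span (range x))) x"

definition seminormalized :: "(nat \<Rightarrow> 'a::real_normed_vector) \<Rightarrow> bool" where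
  "seminormalized x \<longleftrightarrow> 0 < (INF n. norm (x n)) \<and> bdd_above (range (\<lambda>n. norm (x n)))"

definition dominates :: "(nat \<Rightarrow> 'a::real_normed_vector) \<Rightarrow> (nat \<Rightarrow> 'b::real_normed_vector) \<Rightarrow> bool" where
  "dominates x y \<longleftrightarrow> (\<exists>C>0. \<forall>a::nat \<Rightarrow> real. finite {n. a n \<noteq> 0} \<longrightarrow>
      norm (\<Sum>n\<in>{n. a n \<noteq> 0}. a n *\<^sub>R y n) \<le> C * norm (\<Sum>n\<in>{n. a n \<noteq> 0}. a n *\<^sub>R x n))"

definition quasisubsymmetric :: "(nat \<Rightarrow> 'a::real_normed_vector) \<Rightarrow> bool" where
  "quasisubsymmetric x \<longleftrightarrow> basic_sequence x \<and>
     (\<forall>k l :: nat \<Rightarrow> nat. strict_mono k \<and> strict_mono l \<and> (\<forall>n. k n \<le> l n) \<longrightarrow>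
        dominates (x \<circ> k) (x \<circ> l))"

definition biorthogonal :: "(nat \<Rightarrow> 'a::real_normed_vector) \<Rightarrow> (nat \<Rightarrow> ('a \<Rightarrow>\<^sub>L real)) \<Rightarrow> bool" where
  "biorthogonal e es \<longleftrightarrow> (\<forall>n m. blinfun_apply (es n) (e m) = (if n = m then 1 else 0))"

definition embeds_isomorphically :: "'v::real_normed_vector itself \<Rightarrow> 'w::real_normed_vector itself \<Rightarrow> bool" where
  "embeds_isomorphically _ _ \<longleftrightarrow> (\<exists>T :: 'v \<Rightarrow> 'w. bounded_linear T \<and>
      (\<exists>c>0. \<forall>v. c * norm v \<le> norm (T v)))"

end

(* Put d n = es (2n) - es (2n+1). For every set A of indices, quasisubsymmetry makes both spreads
   es n |-> es (2n) and es n |-> es (2n + [n in A]) bounded, and their difference sends es n to d n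
   for n in A and to 0 otherwise. Dually, x |-> (sum over n in A of d n x e n) is bounded for every
   A, so sum |d n x f (e n)| < oo for all x and f, and uniform boundedness yields operators
   U_b x = sum b n d n x e n with |U_b| <= M |b| for all bounded b. Since U_b (e (2j)) = b j e j,
   the map b |-> U_b is an embedding. *)
theory Submission
  imports Defs
begin

section \<open>Banach-Steinhaus via the Baire category theorem\<close>

theorem uniform_boundedness:
  fixes f :: "'i \<Rightarrow> 'a::banach \<Rightarrow>\<^sub>L 'b::real_normed_vector"
  assumes ptwise: "\<And>x. \<exists>M. \<forall>i\<in>I. norm (f i x) \<le> M"
  shows "\<exists>M>0. \<forall>i\<in>I. norm (f i) \<le> M"
proof -
  define E where "E k = (\<Inter>i\<in>I. {x. norm (f i x) \<le> real k})" for k :: nat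
  have closedE: "closed (E k)" for k
    unfolding E_def by (intro closed_INT ballI closed_Collect_le continuous_intros)
  have "x \<in> (\<Union>k. E k)" for x
  proof -
    obtain M where "\<forall>i\<in>I. norm (f i x) \<le> M" using ptwise by blast
    then have "x \<in> E (nat \<lceil>M\<rceil>)"
      unfolding E_def by (auto intro: order_trans real_nat_ceiling_ge)
    then show ?thesis by blast
  qed
  then have UE: "(\<Union>k. E k) = UNIV" by auto
  have "\<exists>k. interior (E k) \<noteq> {}"
  proof (rule ccontr)
    assume none: "\<not> ?thesis"
    have "euclidean interior_of \<Union>(range E) = {}"
      using none closedE
      by (intro Baire_category_alt) (auto simp: completely_metrizable_space_euclidean)
    then show False using UE by simp
  qed
  then obtain k x0 where "x0 \<in> interior (E k)" by blast
  then obtain r where r: "r > 0" "cball x0 r \<subseteq> E k"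
    by (meson mem_interior_cball)
  \<comment> \<open>A vector \<open>z\<close> of norm \<open>r\<close> is the difference of the
    points \<open>x0 + z\<close> and \<open>x0\<close> of \<open>E k\<close>, so
    \<open>f i z\<close> has norm at most \<open>2 * k\<close>; rescaling gives the factor
    \<open>2 * k / r\<close>.\<close>
  have "norm (f i x) \<le> (2 * real k / r) * norm x" if "i \<in> I" for i x
  proof (cases "x = 0")
    case False
    define z where "z = (r / norm x) *\<^sub>R x"
    have "norm z = r" using False r by (simp add: z_def)
    then have "x0 + z \<in> E k" "x0 \<in> E k"
      using r by (auto intro!: subsetD[OF r(2)] simp: dist_norm)
    then have "norm (f i (x0 + z)) \<le> k" "norm (f i x0) \<le> k"
      using that by (auto simp: E_def)
    moreover have "f i z = f i (x0 + z) - f i x0" by (simp add: blinfun.bilinear_simps)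
    ultimately have "norm (f i z) \<le> 2 * k"
      using norm_triangle_ineq4[of "f i (x0 + z)" "f i x0"] by simp
    moreover have "norm (f i z) = r / norm x * norm (f i x)"
      using r by (simp add: z_def blinfun.bilinear_simps)
    ultimately show ?thesis using False r by (simp add: field_simps)
  qed simp
  then have "norm (f i) \<le> 2 * real k / r" if "i \<in> I" for i
    using that r by (intro norm_blinfun_bound) auto
  \<comment> \<open>Since \<open>k\<close> may be 0, adding 1 makes the bound strictly
    positive.\<close>
  moreover have "2 * real k / r + 1 > 0" using r by (intro add_nonneg_pos) auto
  ultimately show ?thesis
    by (intro exI[of _ "2 * real k / r + 1"]) fastforce
qed

section \<open>Sublinear functionals and Hahn-Banach in finitely many directions\<close>

definition sublinear :: "('a::real_vector \<Rightarrow> real) \<Rightarrow> bool" where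
  "sublinear p \<longleftrightarrow> (\<forall>x y. p (x + y) \<le> p x + p y) \<and> (\<forall>c\<ge>0. \<forall>x. p (c *\<^sub>R x) = c * p x)"

lemma sublinear_add: "sublinear p \<Longrightarrow> p (x + y) \<le> p x + p y"
  and sublinear_scale: "sublinear p \<Longrightarrow> c \<ge> 0 \<Longrightarrow> p (c *\<^sub>R x) = c * p x"
  by (auto simp: sublinear_def)

lemma sublinear_zero: "sublinear p \<Longrightarrow> p 0 = 0"
  using sublinear_scale[of p 0 0] by simp

lemma sublinear_minus: "sublinear p \<Longrightarrow> - p (- x) \<le> p x"
  using sublinear_add[of p x "- x"] sublinear_zero[of p] by simp

lemma sublinear_norm: "sublinear norm"
  by (simp add: sublinear_def norm_triangle_ineq)

text \<open>One step of Hahn--Banach, phrased as lowering a sublinear functional until it becomes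
  linear in the direction \<open>v\<close>.\<close>

lemma sublinear_lower:
  assumes p: "sublinear p"
  shows "\<exists>q. sublinear q \<and> (\<forall>x. q x \<le> p x) \<and> q v = p v \<and> q (- v) = - q v"
proof -
  \<comment> \<open>Any sublinear \<open>q\<close> below \<open>p\<close> with
    \<open>q v = p v\<close> and \<open>q (- v) = - p v\<close> satisfies
    \<open>q x \<le> q (x + t v) - t p v \<le> g x t\<close> for \<open>t \<ge> 0\<close>. The
    infimum over \<open>t\<close> is therefore the largest candidate.\<close>
  define g where "g x t = p (x + t *\<^sub>R v) - t * p v" for x t
  define q where "q x = (INF t\<in>{0..}. g x t)" for x
  have "- p (- x) \<le> g x t" if "t \<ge> 0" for x t
    using sublinear_add[OF p, of "x + t *\<^sub>R v" "- x"] sublinear_scale[OF p that, of v]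
    by (simp add: g_def)
  then have bdd: "bdd_below (g x ` {0..})" for x
    by (intro bdd_belowI2) auto
  have upper: "q x \<le> g x t" if "t \<ge> 0" for x t
    unfolding q_def using that by (intro cINF_lower bdd) auto
  have lower: "m \<le> q x" if "\<And>t. t \<ge> 0 \<Longrightarrow> m \<le> g x t" for m x
    unfolding q_def using that by (intro cINF_greatest) auto
  have add: "q (x + y) \<le> q x + q y" for x y
  proof -
    have "q (x + y) \<le> g x s + g y t" if "s \<ge> 0" "t \<ge> 0" for s t
    proof -
      have "q (x + y) \<le> g (x + y) (s + t)" using that by (intro upper) simp
      also have "\<dots> \<le> g x s + g y t"
        using sublinear_add[OF p, of "x + s *\<^sub>R v" "y + t *\<^sub>R v"]
        by (simp add: g_def algebra_simps)
      finally show ?thesis .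
    qed
    then have "q (x + y) - g x s \<le> q y" if "s \<ge> 0" for s
      using that by (intro lower) (simp add: algebra_simps)
    then have "q (x + y) - q y \<le> q x"
      by (intro lower) (simp add: algebra_simps)
    then show ?thesis by simp
  qed
  have scale_le: "q (c *\<^sub>R x) \<le> c * q x" if "c > 0" for c x
  proof -
    have "q (c *\<^sub>R x) / c \<le> g x t" if "t \<ge> 0" for t
    proof -
      have "q (c *\<^sub>R x) \<le> g (c *\<^sub>R x) (c * t)" using that \<open>c > 0\<close> by (intro upper) simp
      also have "\<dots> = c * g x t"
        using sublinear_scale[OF p, of c "x + t *\<^sub>R v"] \<open>c > 0\<close>
        by (simp add: g_def algebra_simps)
      finally show ?thesis using \<open>c > 0\<close> by (simp add: field_simps)
    qed
    then have "q (c *\<^sub>R x) / c \<le> q x" by (rule lower)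
    then show ?thesis using \<open>c > 0\<close> by (simp add: field_simps)
  qed
  have g0: "g 0 t = 0" if "t \<ge> 0" for t
    using that by (simp add: g_def sublinear_scale[OF p])
  have q0: "q 0 = 0"
    using upper[of 0 0] lower[of 0 0] g0 by fastforce
  have scale: "q (c *\<^sub>R x) = c * q x" if "c \<ge> 0" for c x
  proof (cases "c = 0")
    case False
    then have "c > 0" using that by simp
    then show ?thesis
      using scale_le[of c x] scale_le[of "inverse c" "c *\<^sub>R x"] by (simp add: field_simps)
  qed (simp add: q0)
  have q: "sublinear q" using add scale by (simp add: sublinear_def)
  have le: "q x \<le> p x" for x
    using upper[of 0 x] by (simp add: g_def)
  \<comment> \<open>At \<open>t = 1\<close> the argument \<open>- v + v\<close> vanishes and only
    \<open>- p v\<close> is left.\<close>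
  have "q (- v) \<le> - p v"
    using upper[of 1 "- v"] by (simp add: g_def sublinear_zero[OF p])
  then have "q v = p v" "q (- v) = - q v"
    using le[of v] sublinear_minus[OF q, of v] by auto
  then show ?thesis using q le by blast
qed

text \<open>A direction in which \<open>p\<close> is already odd leaves no room for lowering:
  \<open>p v = - p (- v) \<le> - q (- v) \<le> q v \<le> p v\<close>. Successive lowerings thus keep
  what earlier ones achieved.\<close>

lemma sublinear_le_odd:
  assumes "sublinear q" "\<And>x. q x \<le> p x" "p (- v) = - p v"
  shows "q v = p v" "q (- v) = - q v"
  using assms(2)[of v] assms(2)[of "- v"] assms(3) sublinear_minus[OF assms(1), of v] by auto

lemma sublinear_lower_finite:
  assumes "finite B" "sublinear p"
  shows "\<exists>q. sublinear q \<and> (\<forall>x. q x \<le> p x) \<and> (\<forall>v\<in>B. q (- v) = - q v)"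
  using assms(1)
proof (induction B)
  case empty
  then show ?case using assms(2) by auto
next
  case (insert v B)
  then obtain q where q: "sublinear q" "\<forall>x. q x \<le> p x" "\<forall>v\<in>B. q (- v) = - q v" by blast
  obtain r where r: "sublinear r" "\<forall>x. r x \<le> q x" "r (- v) = - r v"
    using sublinear_lower[OF q(1)] by blast
  have "r (- w) = - r w" if "w \<in> B" for w
    using sublinear_le_odd(2)[OF r(1), of q w] r(2) q(3) that by auto
  then show ?case using q r by (intro exI[of _ r]) (auto intro: order_trans)
qed

text \<open>Along an odd vector \<open>w\<close>, subadditivity becomes equality, because
  \<open>q x \<le> q (x + w) + q (- w) = q (x + w) - q w\<close>. Hence \<open>q\<close> is linear
  on the span of the \<open>e i\<close>.\<close>

lemma sublinear_odd_sum:
  assumes q: "sublinear q" and odd: "\<And>i. i \<in> I \<Longrightarrow> q (- e i) = - q (e i)"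
  shows "q (\<Sum>i\<in>I. a i *\<^sub>R e i) = (\<Sum>i\<in>I. a i * q (e i))"
proof -
  have oddc: "q (a i *\<^sub>R e i) = a i * q (e i)" if "i \<in> I" for i
  proof (cases "a i \<ge> 0")
    case False
    then have "q ((- a i) *\<^sub>R (- e i)) = (- a i) * q (- e i)"
      by (intro sublinear_scale q) auto
    then show ?thesis using odd[OF that] by simp
  qed (simp add: sublinear_scale[OF q])
  have oddc': "q (- (a i *\<^sub>R e i)) = - q (a i *\<^sub>R e i)" if "i \<in> I" for i
  proof (cases "a i \<ge> 0")
    case True
    then show ?thesis using odd[OF that] sublinear_scale[OF q, of "a i" "- e i"] oddc[OF that]
      by simp
  next
    case False
    then show ?thesis using sublinear_scale[OF q, of "- a i" "e i"] oddc[OF that] by simp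
  qed
  have add: "q (x + a i *\<^sub>R e i) = q x + q (a i *\<^sub>R e i)" if "i \<in> I" for x i
    using sublinear_add[OF q, of x "a i *\<^sub>R e i"]
      sublinear_add[OF q, of "x + a i *\<^sub>R e i" "- (a i *\<^sub>R e i)"] oddc'[OF that] by simp
  have "J \<subseteq> I \<longrightarrow> q (\<Sum>i\<in>J. a i *\<^sub>R e i) = (\<Sum>i\<in>J. a i * q (e i))" if "finite J" for J
    using that by induction (auto simp: sublinear_zero[OF q] add oddc add.commute[of "_ *\<^sub>R _"])
  then show ?thesis by (cases "finite I") (auto simp: sublinear_zero[OF q])
qed

section \<open>Partial sums of the basis and norming functionals\<close>

lemma basis_expansion:
  assumes "schauder_basis e" "biorthogonal e es"
  shows "(\<lambda>n. es n x *\<^sub>R e n) sums x"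
proof -
  obtain a where a: "(\<lambda>n. a n *\<^sub>R e n) sums x"
    using assms(1) unfolding schauder_basis_def schauder_basis_of_def by blast
  have "es m x = a m" for m
  proof -
    have "(\<lambda>n. es m (a n *\<^sub>R e n)) sums es m x"
      by (rule bounded_linear.sums[OF blinfun.bounded_linear_right a])
    also have "(\<lambda>n. es m (a n *\<^sub>R e n)) = (\<lambda>n. if n = m then a n else 0)"
      using assms(2) by (auto simp: biorthogonal_def blinfun.bilinear_simps)
    finally show ?thesis
      using sums_unique2 sums_single by blast
  qed
  then show ?thesis using a by simp
qed

text \<open>The partial sum operators converge pointwise, hence are pointwise bounded, and uniform
  boundedness applies. \<open>K\<close> is a basis constant.\<close>

lemma basis_constant:
  fixes e :: "nat \<Rightarrow> 'a::banach" and es :: "nat \<Rightarrow> 'a \<Rightarrow>\<^sub>L real"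
  assumes "\<And>x. (\<lambda>n. es n x *\<^sub>R e n) sums x"
  shows "\<exists>K>0. \<forall>N x. norm (\<Sum>n<N. es n x *\<^sub>R e n) \<le> K * norm x"
proof -
  define P where "P N = (\<Sum>n<N. blinfun_scaleR_left (e n) o\<^sub>L es n)" for N
  have P: "P N x = (\<Sum>n<N. es n x *\<^sub>R e n)" for N x
    by (simp add: P_def blinfun.sum_left)
  have "\<exists>M. \<forall>N\<in>UNIV. norm (P N x) \<le> M" for x
    using assms[of x] convergent_imp_Bseq[of "\<lambda>N. P N x"]
    unfolding sums_def P by (auto simp: convergent_def Bseq_def)
  from uniform_boundedness[OF this] obtain M where M: "M > 0" "\<And>N. norm (P N) \<le> M" by blast
  have "norm (P N x) \<le> M * norm x" for N x
    using norm_blinfun[of "P N" x] mult_right_mono[OF M(2) norm_ge_zero] by (rule order_trans)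
  then show ?thesis using M(1) unfolding P by blast
qed

text \<open>A Hahn-Banach functional norming \<open>y\<close> is replaced by one in the span of the
  \<open>es n\<close>, at the price of norm \<open>K\<close> instead of 1. This lets estimates on
  combinations of the \<open>es n\<close> be turned into norm estimates in the space.\<close>

lemma norming_functional:
  fixes e :: "nat \<Rightarrow> 'a::real_normed_vector" and es :: "nat \<Rightarrow> 'a \<Rightarrow>\<^sub>L real"
  assumes bi: "biorthogonal e es"
    and K: "K \<ge> 0" "\<And>N x. norm (\<Sum>n<N. es n x *\<^sub>R e n) \<le> K * norm x"
    and y: "y = (\<Sum>n<N. a n *\<^sub>R e n)"
  shows "\<exists>c. norm y = (\<Sum>n<N. c n *\<^sub>R es n) y \<and> norm y = (\<Sum>n<N. c n * a n) \<and>
    norm (\<Sum>n<N. c n *\<^sub>R es n) \<le> K"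
proof -
  \<comment> \<open>Lowering first along \<open>y\<close> fixes the value \<open>norm y\<close>; the
    later lowering along the \<open>e n\<close> cannot change it.\<close>
  obtain p where p: "sublinear p" "\<forall>x. p x \<le> norm x" "p y = norm y" "p (- y) = - p y"
    using sublinear_lower[OF sublinear_norm] by blast
  obtain q where q: "sublinear q" "\<forall>x. q x \<le> p x" "\<forall>v\<in>e ` {..<N}. q (- v) = - q v"
    using sublinear_lower_finite[OF _ p(1), of "e ` {..<N}"] by auto
  have qy: "q y = norm y"
    using sublinear_le_odd(1)[OF q(1), of p y] q(2) p by auto
  have qsum: "q (\<Sum>n<N. b n *\<^sub>R e n) = (\<Sum>n<N. b n * q (e n))" for b
    using q(3) by (intro sublinear_odd_sum q(1)) auto
  have q_abs: "\<bar>q x\<bar> \<le> norm x" for x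
  proof -
    have "q x \<le> norm x" "q (- x) \<le> norm x"
      using p(2) q(2) by (metis order_trans norm_minus_cancel)+
    then show ?thesis using sublinear_minus[OF q(1), of x] by auto
  qed
  \<comment> \<open>\<open>q\<close> is known to be linear only on the span of the first
    \<open>N\<close> basis vectors. Composing it with the partial sum projection yields a genuine
    functional with coefficients \<open>q (e n)\<close>.\<close>
  have f: "(\<Sum>n<N. q (e n) *\<^sub>R es n) x = q (\<Sum>n<N. es n x *\<^sub>R e n)" for x
    by (simp add: blinfun.bilinear_simps qsum mult.commute)
  have "norm ((\<Sum>n<N. q (e n) *\<^sub>R es n) x) \<le> K * norm x" for x
    unfolding f using q_abs K(2) by (auto intro: order_trans)
  then have 1: "norm (\<Sum>n<N. q (e n) *\<^sub>R es n) \<le> K"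
    using K(1) by (intro norm_blinfun_bound) auto
  have "es n y = a n" if "n < N" for n
    using bi that by (simp add: y blinfun.bilinear_simps biorthogonal_def if_distrib[of "\<lambda>u. _ * u"] cong: if_cong)
  then have "(\<Sum>n<N. es n y *\<^sub>R e n) = y" by (simp add: y)
  then have 2: "(\<Sum>n<N. q (e n) *\<^sub>R es n) y = norm y" using f[of y] qy by simp
  have "norm y = (\<Sum>n<N. q (e n) * a n)"
    using qsum[of a] qy y by (simp add: mult.commute)
  with 1 2 show ?thesis by (intro exI[of _ "\<lambda>n. q (e n)"]) simp
qed

section \<open>Spreads of the biorthogonal sequence and their differences\<close>

lemma dominates_sum:
  assumes "dominates x y"
  shows "\<exists>C>0. \<forall>N a. norm (\<Sum>n<N. a n *\<^sub>R y n) \<le> C * norm (\<Sum>n<N. a n *\<^sub>R x n)"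
proof -
  obtain C where C: "C > 0" "\<And>a. finite {n. a n \<noteq> 0} \<Longrightarrow>
      norm (\<Sum>n\<in>{n. a n \<noteq> 0}. a n *\<^sub>R y n) \<le> C * norm (\<Sum>n\<in>{n. a n \<noteq> 0}. a n *\<^sub>R x n)"
    using assms unfolding dominates_def by blast
  have "norm (\<Sum>n<N. a n *\<^sub>R y n) \<le> C * norm (\<Sum>n<N. a n *\<^sub>R x n)" for N and a :: "nat \<Rightarrow> real"
  proof -
    \<comment> \<open>Cutting off at \<open>N\<close> makes the support finite; terms below
      \<open>N\<close> outside the support contribute 0 to both sums.\<close>
    define b where "b n = (if n < N then a n else 0)" for n
    have sub: "{n. b n \<noteq> 0} \<subseteq> {..<N}" by (auto simp: b_def)
    then have "finite {n. b n \<noteq> 0}" using finite_subset by blast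
    from C(2)[OF this]
    have "norm (\<Sum>n<N. b n *\<^sub>R y n) \<le> C * norm (\<Sum>n<N. b n *\<^sub>R x n)"
      using sub sum.mono_neutral_left[of "{..<N}" "{n. b n \<noteq> 0}" "\<lambda>n. b n *\<^sub>R y n"]
        sum.mono_neutral_left[of "{..<N}" "{n. b n \<noteq> 0}" "\<lambda>n. b n *\<^sub>R x n"] by auto
    then show ?thesis by (simp add: b_def)
  qed
  then show ?thesis using C(1) by blast
qed

text \<open>Duality: a strictly increasing \<open>l\<close> satisfies \<open>n \<le> l n\<close>, so
  \<open>es\<close> dominates \<open>es \<circ> l\<close>. Testing the sum in the space against a
  norming combination of the \<open>es n\<close> moves the spread onto that combination, which costs
  \<open>C\<close>, while norming costs \<open>K\<close>.\<close>

lemma spread_bounded: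
  fixes e :: "nat \<Rightarrow> 'a::real_normed_vector" and es :: "nat \<Rightarrow> 'a \<Rightarrow>\<^sub>L real"
  assumes bi: "biorthogonal e es" and qs: "quasisubsymmetric es" and l: "strict_mono l"
    and K: "K \<ge> 0" "\<And>N x. norm (\<Sum>n<N. es n x *\<^sub>R e n) \<le> K * norm x"
  shows "\<exists>C. \<forall>N x. norm (\<Sum>n<N. es (l n) x *\<^sub>R e n) \<le> C * norm x"
proof -
  have "dominates (es \<circ> id) (es \<circ> l)"
    using qs l strict_mono_imp_increasing[OF l] unfolding quasisubsymmetric_def
    by (metis id_apply strict_mono_id)
  from dominates_sum[OF this] obtain C where C: "C > 0"
    "\<And>N a. norm (\<Sum>n<N. a n *\<^sub>R es (l n)) \<le> C * norm (\<Sum>n<N. a n *\<^sub>R es n)"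
    by auto
  have "norm (\<Sum>n<N. es (l n) x *\<^sub>R e n) \<le> (C * K) * norm x" for N x
  proof -
    define y where "y = (\<Sum>n<N. es (l n) x *\<^sub>R e n)"
    obtain c where c: "norm y = (\<Sum>n<N. c n * es (l n) x)" "norm (\<Sum>n<N. c n *\<^sub>R es n) \<le> K"
      using norming_functional[OF bi K y_def] by blast
    have "norm y = (\<Sum>n<N. c n *\<^sub>R es (l n)) x" by (simp add: c blinfun.bilinear_simps)
    also have "\<dots> \<le> norm (\<Sum>n<N. c n *\<^sub>R es (l n)) * norm x"
      using norm_blinfun[of "\<Sum>n<N. c n *\<^sub>R es (l n)" x] by simp
    also have "\<dots> \<le> (C * K) * norm x"
      using C(2)[where a = c and N = N] c(2) C(1)
      by (intro mult_right_mono) (auto intro: order_trans)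
    finally show ?thesis by (simp add: y_def)
  qed
  then show ?thesis by blast
qed

lemma difference_bounded:
  fixes e :: "nat \<Rightarrow> 'a::real_normed_vector" and es :: "nat \<Rightarrow> 'a \<Rightarrow>\<^sub>L real"
  assumes bi: "biorthogonal e es" and qs: "quasisubsymmetric es"
    and K: "K \<ge> 0" "\<And>N x. norm (\<Sum>n<N. es n x *\<^sub>R e n) \<le> K * norm x"
  shows "\<exists>D. \<forall>N x. norm (\<Sum>n<N. (if n \<in> A then (es (2*n) - es (2*n+1)) x else 0) *\<^sub>R e n) \<le> D * norm x"
proof -
  \<comment> \<open>The value lies in the block \<open>{2n, 2n+1}\<close>, so \<open>l B\<close> is
    strictly increasing for every \<open>B\<close>. The spreads for \<open>{}\<close> and
    \<open>A\<close> differ exactly on \<open>A\<close>.\<close>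
  define l where "l B n = 2 * n + (if n \<in> B then 1 else 0)" for B and n :: nat
  have "strict_mono (l B)" for B
    by (auto simp: strict_mono_Suc_iff l_def)
  from spread_bounded[OF bi qs this K]
  have "\<exists>C. \<forall>N x. norm (\<Sum>n<N. es (l B n) x *\<^sub>R e n) \<le> C * norm x" for B .
  then obtain C where C: "\<And>B N x. norm (\<Sum>n<N. es (l B n) x *\<^sub>R e n) \<le> C B * norm x" by metis
  have "norm (\<Sum>n<N. (if n \<in> A then (es (2*n) - es (2*n+1)) x else 0) *\<^sub>R e n) \<le> (C {} + C A) * norm x" for N x
  proof -
    have "(\<Sum>n<N. (if n \<in> A then (es (2*n) - es (2*n+1)) x else 0) *\<^sub>R e n)
        = (\<Sum>n<N. es (l {} n) x *\<^sub>R e n) - (\<Sum>n<N. es (l A n) x *\<^sub>R e n)"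
      unfolding sum_subtractf[symmetric]
      by (intro sum.cong) (auto simp: l_def blinfun.bilinear_simps scaleR_left_diff_distrib)
    also have "norm \<dots> \<le> C {} * norm x + C A * norm x"
      by (intro norm_triangle_le_diff add_mono C)
    finally show ?thesis by (simp add: algebra_simps)
  qed
  then show ?thesis by blast
qed

section \<open>From subsets to bounded multipliers\<close>

lemma sum_abs_le_of_subset_sums:
  fixes z :: "nat \<Rightarrow> real"
  assumes "\<And>A. \<exists>M. \<forall>N. \<bar>\<Sum>n<N. if n \<in> A then z n else 0\<bar> \<le> M"
  shows "\<exists>M. \<forall>N. (\<Sum>n<N. \<bar>z n\<bar>) \<le> M"
proof -
  obtain M where M: "\<And>A N. \<bar>\<Sum>n<N. if n \<in> A then z n else 0\<bar> \<le> M A" using assms by metis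
  let ?A = "{n. z n \<ge> 0}"
  have "(\<Sum>n<N. \<bar>z n\<bar>) \<le> M ?A + M (- ?A)" for N
  proof -
    have "(\<Sum>n<N. \<bar>z n\<bar>) = (\<Sum>n<N. if n \<in> ?A then z n else 0) - (\<Sum>n<N. if n \<in> - ?A then z n else 0)"
      unfolding sum_subtractf[symmetric] by (intro sum.cong) auto
    then show ?thesis using M[where A = ?A and N = N] M[where A = "- ?A" and N = N] by linarith
  qed
  then show ?thesis by blast
qed

text \<open>The constants \<open>D\<close> in \<open>sub\<close> may depend on \<open>A\<close>
  without control. Uniformity in \<open>b\<close> and \<open>N\<close> comes from applying uniform
  boundedness twice: on the dual space for fixed \<open>x\<close>, then on the space itself.\<close>

lemma multiplier_bounded:
  fixes e :: "nat \<Rightarrow> 'a::banach" and es :: "nat \<Rightarrow> 'a \<Rightarrow>\<^sub>L real" and d :: "nat \<Rightarrow> 'a \<Rightarrow>\<^sub>L real"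
  assumes bi: "biorthogonal e es"
    and K: "K \<ge> 0" "\<And>N x. norm (\<Sum>n<N. es n x *\<^sub>R e n) \<le> K * norm x"
    and sub: "\<And>A. \<exists>D. \<forall>N x. norm (\<Sum>n<N. (if n \<in> A then d n x else 0) *\<^sub>R e n) \<le> D * norm x"
  shows "\<exists>M>0. \<forall>N b x. (\<forall>n. \<bar>b n\<bar> \<le> 1) \<longrightarrow> norm (\<Sum>n<N. (b n * d n x) *\<^sub>R e n) \<le> M * norm x"
proof -
  define I :: "((nat \<Rightarrow> real) \<times> nat) set" where "I = {b. \<forall>n. \<bar>b n\<bar> \<le> 1} \<times> UNIV"
  define U where "U = (\<lambda>(b, N). \<Sum>n<N. b n *\<^sub>R (blinfun_scaleR_left (e n) o\<^sub>L d n))"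
  have U: "U (b, N) x = (\<Sum>n<N. (b n * d n x) *\<^sub>R e n)" for b N x
    by (simp add: U_def blinfun.bilinear_simps blinfun.sum_left)
  \<comment> \<open>For fixed \<open>x\<close> and \<open>f\<close>, subset sums of the scalar
    series are images under \<open>f\<close> of the sums bounded by \<open>sub\<close>, so the
    series converges absolutely.\<close>
  have scalar: "\<exists>M. \<forall>N. (\<Sum>n<N. \<bar>d n x * f (e n)\<bar>) \<le> M" for x and f :: "'a \<Rightarrow>\<^sub>L real"
  proof (rule sum_abs_le_of_subset_sums)
    fix A
    obtain D where D: "\<And>N. norm (\<Sum>n<N. (if n \<in> A then d n x else 0) *\<^sub>R e n) \<le> D * norm x"
      using sub[of A] by blast
    have "\<bar>\<Sum>n<N. if n \<in> A then d n x * f (e n) else 0\<bar> \<le> norm f * (D * norm x)" for N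
    proof -
      have "(\<Sum>n<N. if n \<in> A then d n x * f (e n) else 0)
          = f (\<Sum>n<N. (if n \<in> A then d n x else 0) *\<^sub>R e n)"
        by (auto simp: blinfun.bilinear_simps intro!: sum.cong)
      also have "\<bar>\<dots>\<bar> \<le> norm f * norm (\<Sum>n<N. (if n \<in> A then d n x else 0) *\<^sub>R e n)"
        using norm_blinfun[of f] by simp
      also have "\<dots> \<le> norm f * (D * norm x)" by (intro mult_left_mono D) simp
      finally show ?thesis .
    qed
    then show "\<exists>M. \<forall>N. \<bar>\<Sum>n<N. if n \<in> A then d n x * f (e n) else 0\<bar> \<le> M" by blast
  qed
  have "\<exists>M. \<forall>i\<in>I. norm (U i x) \<le> M" for x
  proof -
    \<comment> \<open>\<open>\<phi> i\<close> is \<open>U i x\<close> viewed as an element of the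
      bidual.\<close>
    define \<phi> where "\<phi> i = Blinfun (\<lambda>f :: 'a \<Rightarrow>\<^sub>L real. f (U i x))" for i
    have \<phi>: "\<phi> i f = f (U i x)" for i f
      unfolding \<phi>_def by (simp add: bounded_linear_Blinfun_apply blinfun.bounded_linear_left)
    have "\<exists>M. \<forall>i\<in>I. norm (\<phi> i f) \<le> M" for f
    proof -
      obtain M where M: "\<And>N. (\<Sum>n<N. \<bar>d n x * f (e n)\<bar>) \<le> M" using scalar by blast
      have "norm (\<phi> (b, N) f) \<le> M" if "\<forall>n. \<bar>b n\<bar> \<le> 1" for b N
      proof -
        have "norm (\<phi> (b, N) f) = \<bar>\<Sum>n<N. b n * (d n x * f (e n))\<bar>"
          by (simp add: \<phi> U blinfun.bilinear_simps mult.assoc)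
        also have "\<dots> \<le> (\<Sum>n<N. \<bar>b n\<bar> * \<bar>d n x * f (e n)\<bar>)"
          using sum_abs[of "\<lambda>n. b n * (d n x * f (e n))"] by (simp only: abs_mult)
        also have "\<dots> \<le> (\<Sum>n<N. \<bar>d n x * f (e n)\<bar>)"
          using that by (intro sum_mono mult_left_le_one_le) auto
        finally show ?thesis using M[of N] by linarith
      qed
      then show ?thesis by (auto simp: I_def)
    qed
    from uniform_boundedness[OF this] obtain M where M: "M > 0" "\<forall>i\<in>I. norm (\<phi> i) \<le> M" by blast
    \<comment> \<open>\<open>U (b, N) x\<close> lies in the span of the first \<open>N\<close> basis
      vectors, so a functional of norm at most \<open>K\<close> norms it; this carries the bound on
      \<open>\<phi>\<close> back to the space.\<close>
    have "norm (U (b, N) x) \<le> M * K" if "(b, N) \<in> I" for b N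
    proof -
      obtain c where c: "norm (U (b, N) x) = (\<Sum>n<N. c n *\<^sub>R es n) (U (b, N) x)"
          "norm (\<Sum>n<N. c n *\<^sub>R es n) \<le> K"
        using norming_functional[OF bi K U] by blast
      have "norm (U (b, N) x) = \<phi> (b, N) (\<Sum>n<N. c n *\<^sub>R es n)" by (simp add: \<phi> c(1))
      also have "\<dots> \<le> norm (\<phi> (b, N)) * norm (\<Sum>n<N. c n *\<^sub>R es n)"
        using norm_blinfun[of "\<phi> (b, N)" "\<Sum>n<N. c n *\<^sub>R es n"] by simp
      also have "\<dots> \<le> M * K" using M that c(2) by (intro mult_mono) auto
      finally show ?thesis .
    qed
    then show ?thesis by (metis surj_pair)
  qed
  from uniform_boundedness[OF this] obtain M where M: "M > 0" "\<forall>i\<in>I. norm (U i) \<le> M" by blast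
  have "norm (\<Sum>n<N. (b n * d n x) *\<^sub>R e n) \<le> M * norm x" if "\<forall>n. \<bar>b n\<bar> \<le> 1" for N b x
  proof -
    have "(b, N) \<in> I" using that by (simp add: I_def)
    then have "norm (U (b, N)) * norm x \<le> M * norm x" using M by (intro mult_right_mono) auto
    then show ?thesis using norm_blinfun[of "U (b, N)" x] by (simp add: U)
  qed
  then show ?thesis using M(1) by blast
qed

section \<open>The multiplier operators and the embedding\<close>

theorem theorem2p9:
  fixes e :: "nat \<Rightarrow> 'a::banach" and es :: "nat \<Rightarrow> ('a \<Rightarrow>\<^sub>L real)"
  assumes "schauder_basis e"
    and "seminormalized e"
    and "biorthogonal e es"
    and "quasisubsymmetric es"
  shows "embeds_isomorphically TYPE(nat \<Rightarrow>\<^sub>C real) TYPE('a \<Rightarrow>\<^sub>L 'a)"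
proof -
  note bi = assms(3)
  note expansion = basis_expansion[OF assms(1) bi]
  obtain K where K: "K \<ge> 0" "\<And>N x. norm (\<Sum>n<N. es n x *\<^sub>R e n) \<le> K * norm x"
    using basis_constant[OF expansion] by (metis less_imp_le)
  define d where "d n = es (2*n) - es (2*n+1)" for n
  \<comment> \<open>As \<open>nat\<close> is discrete, every bounded sequence is a bounded
    continuous function, so \<open>nat \<Rightarrow>\<^sub>C real\<close> with the supremum norm is
    the space of bounded sequences.\<close>
  define V where "V b N x = (\<Sum>n<N. (apply_bcontfun b n * d n x) *\<^sub>R e n)"
    for b :: "nat \<Rightarrow>\<^sub>C real" and N x
  obtain M where M: "M > 0"
    "\<And>N b x. (\<forall>n. \<bar>b n\<bar> \<le> 1) \<Longrightarrow> norm (\<Sum>n<N. (b n * d n x) *\<^sub>R e n) \<le> M * norm x"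
    using multiplier_bounded[OF bi K, of d] difference_bounded[OF bi assms(4) K]
    unfolding d_def by blast
  have V_bound: "norm (V b N x) \<le> M * norm b * norm x" for b N x
  proof (cases "b = 0")
    case False
    then have nb: "norm b > 0" by simp
    have "\<forall>n. \<bar>apply_bcontfun b n / norm b\<bar> \<le> 1"
      using nb norm_bounded[of b] by (auto simp: field_simps)
    note M(2)[OF this, where N = N and x = x]
    moreover have "(\<Sum>n<N. (apply_bcontfun b n / norm b * d n x) *\<^sub>R e n) = V b N x /\<^sub>R norm b"
      by (simp add: V_def scaleR_sum_right divide_inverse mult_ac)
    ultimately show ?thesis using nb by (simp add: field_simps)
  qed (simp add: V_def)
  have V_diff: "V b N (x - y) = V b N x - V b N y" for b N x y
    by (simp add: V_def blinfun.bilinear_simps algebra_simps sum_subtractf)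
  have V_add: "V b N (x + y) = V b N x + V b N y" for b N x y
    by (simp add: V_def blinfun.bilinear_simps algebra_simps sum.distrib)
  have V_scale: "V b N (r *\<^sub>R x) = r *\<^sub>R V b N x" for b N x r
    by (simp add: V_def blinfun.bilinear_simps scaleR_sum_right mult_ac)
  have V_add': "V (b + b') N x = V b N x + V b' N x" for b b' N x
    by (simp add: V_def algebra_simps sum.distrib)
  have V_scale': "V (r *\<^sub>R b) N x = r *\<^sub>R V b N x" for b N x r
    by (simp add: V_def scaleR_sum_right mult_ac)
  \<comment> \<open>For \<open>n \<ge> L\<close> both \<open>2n\<close> and \<open>2n+1\<close> are
    at least \<open>L\<close>, so \<open>d n\<close> kills the first \<open>L\<close> basis vectors
    and the sums are constant from \<open>L\<close> on.\<close>
  have V_stable: "V b N (\<Sum>m<L. a m *\<^sub>R e m) = V b L (\<Sum>m<L. a m *\<^sub>R e m)" if "N \<ge> L" for b N L a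
  proof -
    have "d n (\<Sum>m<L. a m *\<^sub>R e m) = 0" if "n \<ge> L" for n
      using bi that by (auto simp: d_def blinfun.bilinear_simps biorthogonal_def intro!: sum.neutral)
    then show ?thesis
      unfolding V_def using that by (intro sum.mono_neutral_right) auto
  qed
  \<comment> \<open>The sums stabilise on each partial sum \<open>P L\<close> of \<open>x\<close>,
    and \<open>V_bound\<close> controls the remainder \<open>x - P L\<close> uniformly in
    \<open>N\<close>.\<close>
  have "Cauchy (\<lambda>N. V b N x)" for b x
  proof (rule CauchyI)
    fix \<epsilon> :: real assume "\<epsilon> > 0"
    define P where "P L = (\<Sum>m<L. es m x *\<^sub>R e m)" for L
    have "(\<lambda>L. M * norm b * norm (x - P L)) \<longlonglongrightarrow> M * norm b * norm (x - x)"
      using expansion[of x] unfolding sums_def P_def by (intro tendsto_intros)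
    then have "eventually (\<lambda>L. M * norm b * norm (x - P L) < \<epsilon> / 2) sequentially"
      using \<open>\<epsilon> > 0\<close> by (intro order_tendstoD(2)) auto
    then obtain L where L: "M * norm b * norm (x - P L) < \<epsilon> / 2"
      by (meson eventually_sequentially order_refl)
    have near: "norm (V b N x - V b L (P L)) < \<epsilon> / 2" if "N \<ge> L" for N
    proof -
      have "V b N x - V b L (P L) = V b N (x - P L)"
        using V_stable[OF that, of b "\<lambda>m. es m x"] by (simp add: V_diff P_def)
      then show ?thesis using V_bound[of b N "x - P L"] L by simp
    qed
    have "norm (V b m x - V b n x) < \<epsilon>" if "m \<ge> L" "n \<ge> L" for m n
      using norm_triangle_ineq4[of "V b m x - V b L (P L)" "V b n x - V b L (P L)"]
        near[OF that(1)] near[OF that(2)] by simp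
    then show "\<exists>L. \<forall>m\<ge>L. \<forall>n\<ge>L. norm (V b m x - V b n x) < \<epsilon>" by blast
  qed
  then have "\<exists>w. (\<lambda>N. V b N x) \<longlonglongrightarrow> w" for b x
    using Cauchy_convergent_iff convergent_def by blast
  then obtain W where W: "\<And>b x. (\<lambda>N. V b N x) \<longlonglongrightarrow> W b x" by metis
  have W_bound: "norm (W b x) \<le> M * norm b * norm x" for b x
    by (rule Lim_bounded[OF tendsto_norm[OF W]]) (intro allI impI V_bound)
  have W_linear: "bounded_linear (W b)" for b
  proof (rule bounded_linear_intro)
    show "W b (x + y) = W b x + W b y" for x y
      using W[of b "x + y"] tendsto_add[OF W[of b x] W[of b y]] unfolding V_add
      by (rule LIMSEQ_unique)
    show "W b (r *\<^sub>R x) = r *\<^sub>R W b x" for r x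
      using W[of b "r *\<^sub>R x"] tendsto_scaleR[OF tendsto_const W[of b x]] unfolding V_scale
      by (rule LIMSEQ_unique)
    show "norm (W b x) \<le> norm x * (M * norm b)" for x
      using W_bound[of b x] by (simp add: mult_ac)
  qed
  define T where "T b = Blinfun (W b)" for b
  have T: "T b x = W b x" for b x
    by (simp add: T_def bounded_linear_Blinfun_apply[OF W_linear])
  have T_linear: "bounded_linear T"
  proof (rule bounded_linear_intro)
    show "T (b + b') = T b + T b'" for b b'
    proof (rule blinfun_eqI)
      fix x
      show "T (b + b') x = (T b + T b') x"
        using W[of "b + b'" x] tendsto_add[OF W[of b x] W[of b' x]]
        unfolding V_add' T blinfun.add_left by (rule LIMSEQ_unique)
    qed
    show "T (r *\<^sub>R b) = r *\<^sub>R T b" for r b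
    proof (rule blinfun_eqI)
      fix x
      show "T (r *\<^sub>R b) x = (r *\<^sub>R T b) x"
        using W[of "r *\<^sub>R b" x] tendsto_scaleR[OF tendsto_const W[of b x]]
        unfolding V_scale' T blinfun.scaleR_left by (rule LIMSEQ_unique)
    qed
    show "norm (T b) \<le> norm b * M" for b
      using M(1) W_bound[of b] by (intro norm_blinfun_bound) (auto simp: T mult_ac)
  qed
  define \<delta> where "\<delta> = (INF n. norm (e n))"
  have "\<delta> > 0" using assms(2) by (simp add: seminormalized_def \<delta>_def)
  have \<delta>: "\<delta> \<le> norm (e n)" for n
    unfolding \<delta>_def by (intro cINF_lower bdd_belowI2[of _ 0]) auto
  obtain S where S: "\<And>n. norm (e n) \<le> S"
    using assms(2) unfolding seminormalized_def bdd_above_def by auto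
  have "S > 0" using \<open>\<delta> > 0\<close> \<delta>[of 0] S[of 0] by linarith
  \<comment> \<open>By parity \<open>d n\<close> sees \<open>e (2 * j)\<close> only through
    \<open>es (2 * n)\<close>, hence only for \<open>n = j\<close>, so \<open>T b\<close> reveals
    the single coordinate \<open>b j\<close>.\<close>
  have diagonal: "T b (e (2 * j)) = apply_bcontfun b j *\<^sub>R e j" for b j
  proof -
    have "d n (e (2 * j)) = (if n = j then 1 else 0)" for n
      using bi by (auto simp: d_def blinfun.bilinear_simps biorthogonal_def; presburger)
    then have "V b N (e (2 * j)) = (\<Sum>n<N. if n = j then apply_bcontfun b j *\<^sub>R e j else 0)" for N
      unfolding V_def by (intro sum.cong) auto
    then have "V b N (e (2 * j)) = apply_bcontfun b j *\<^sub>R e j" if "N > j" for N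
      using that by simp
    then have "(\<lambda>N. V b N (e (2 * j))) \<longlonglongrightarrow> apply_bcontfun b j *\<^sub>R e j"
      by (intro tendsto_eventually eventually_mono[OF eventually_gt_at_top[of j]]) auto
    with W show ?thesis unfolding T by (rule LIMSEQ_unique)
  qed
  \<comment> \<open>Testing on \<open>e (2 * j)\<close> gives
    \<open>\<bar>b j\<bar> * \<delta> \<le> norm (T b) * S\<close>, where the lower bound
    \<open>\<delta>\<close> is used for \<open>e j\<close> and the upper bound \<open>S\<close> for
    \<open>e (2 * j)\<close>; then the supremum over \<open>j\<close> is taken.\<close>
  have "(\<delta> / S) * norm b \<le> norm (T b)" for b
  proof -
    have "norm (apply_bcontfun b j) \<le> norm (T b) * S / \<delta>" for j
    proof -
      have "\<bar>apply_bcontfun b j\<bar> * \<delta> \<le> norm (T b (e (2 * j)))"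
        unfolding diagonal norm_scaleR by (intro mult_left_mono \<delta>) simp
      also have "\<dots> \<le> norm (T b) * S"
        by (rule order_trans[OF norm_blinfun]) (intro mult_left_mono S norm_ge_zero)
      finally show ?thesis using \<open>\<delta> > 0\<close> by (simp add: field_simps)
    qed
    then have "norm b \<le> norm (T b) * S / \<delta>" by (rule norm_bound)
    then show ?thesis using \<open>\<delta> > 0\<close> \<open>S > 0\<close> by (simp add: field_simps)
  qed
  then show ?thesis
    unfolding embeds_isomorphically_def using T_linear \<open>\<delta> > 0\<close> \<open>S > 0\<close>
    by (intro exI[of _ T] conjI exI[of _ "\<delta> / S"]) auto
qed

end
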